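(* Let $d\ge 0$ and let $\Delta$ be a $d$-dimensional simplicial complex that is $d$-fold acyclic over a field $\Bbbk$. Then the face poset of $\Delta$ can be decomposed into disjoint rank $d$ boolean intervals, the minimal faces of which together form a subcomplex of $\Delta$.
   Context: A simplicial complex is a nonempty collection of subsets (faces) of a finite set closed under taking subsets; the empty set is a face. The face poset is the set of all faces, including the empty face, ordered by inclusion. The dimension of a face $\sigma$ is $|\sigma|-1$ and $\dim\Delta$ is the maximum dimension of a face. The link of a face $\sigma$ is $\operatorname{link}_\Delta\sigma=\{\tau\in\Delta : \tau\cup\sigma\in\Delta,\ \tau\cap\sigma=\varnothing\}$. A complex is acyclic (over $\Bbbk$) if all its reduced homology groups over $\Bbbk$ (including degree $-1$) vanish. $\Delta$ is $k$-fold acyclic if $\operatorname{link}_\Delta\sigma$ is acyclic for all $\sigma\in\Delta$ with $|\sigma|<k$. An interval $[x,y]=\{z: x\le z\le y\}$ of a poset is a rank $k$ boolean interval if it is isomorphic to $2^{[k]}$, the poset of subsets of $\{1,\dots,k\}$ ordered by inclusion. *)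

theory Defs
  imports "HOL-Algebra.Elementary_Groups" "HOL-Library.Disjoint_Sets"
begin

section \<open>Simplicial complexes\<close>

definition simplicial_complex :: "'a set set \<Rightarrow> bool" where
  "simplicial_complex \<Delta> \<longleftrightarrow>
     \<Delta> \<noteq> {} \<and> (\<exists>V. finite V \<and> \<Delta> \<subseteq> Pow V) \<and> (\<forall>\<sigma>\<in>\<Delta>. \<forall>\<tau>. \<tau> \<subseteq> \<sigma> \<longrightarrow> \<tau> \<in> \<Delta>)"

definition face_dim :: "'a set \<Rightarrow> int" where
  "face_dim \<sigma> = int (card \<sigma>) - 1"

definition complex_dim :: "'a set set \<Rightarrow> int" where
  "complex_dim \<Delta> = Max (face_dim ` \<Delta>)"

definition subcomplex :: "'a set set \<Rightarrow> 'a set set \<Rightarrow> bool" where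
  "subcomplex \<Gamma> \<Delta> \<longleftrightarrow> simplicial_complex \<Gamma> \<and> \<Gamma> \<subseteq> \<Delta>"

definition link :: "'a set set \<Rightarrow> 'a set \<Rightarrow> 'a set set" where
  "link \<Delta> \<sigma> = {\<tau>\<in>\<Delta>. \<tau> \<union> \<sigma> \<in> \<Delta> \<and> \<tau> \<inter> \<sigma> = {}}"


section \<open>Reduced simplicial homology over a field\<close>

text \<open>
  The signs in the simplicial boundary map depend on a total order of the vertices. We fix one
  arbitrary linear order on each vertex type, so that all complexes on that type (in particular
  a complex and its links) are oriented compatibly. Up to isomorphism, homology does not depend on
  this choice.
\<close>

definition vertex_order :: "'a rel" where
  "vertex_order = (SOME r. linear_order_on UNIV r)"

definition vertex_less :: "'a \<Rightarrow> 'a \<Rightarrow> bool" where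
  "vertex_less v w \<longleftrightarrow> (v, w) \<in> vertex_order \<and> v \<noteq> w"

text \<open>
  An \<open>i\<close>-chain is the function assigning to each face its coefficient, and is zero off the
  \<open>i\<close>-dimensional faces. The degree ranges over all integers; the empty face has dimension
  \<open>- 1\<close>, which makes the homology reduced.
\<close>

definition chain_group :: "int \<Rightarrow> 'a set set \<Rightarrow> ('a set \<Rightarrow> 'k::field) monoid" where
  "chain_group i \<Delta> =
     \<lparr>carrier = {c. \<forall>\<sigma>. c \<sigma> \<noteq> 0 \<longrightarrow> \<sigma> \<in> \<Delta> \<and> face_dim \<sigma> = i},
      monoid.mult = (\<lambda>c c' \<sigma>. c \<sigma> + c' \<sigma>),
      one = (\<lambda>\<sigma>. 0)\<rparr>"

text \<open>
  On basis elements, \<open>\<partial>[\<sigma>] = \<Sum>\<^sub>v (-1)^(position of v in \<sigma>) [\<sigma> - {v}]\<close>, with positions counted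
  from 0. Collecting the coefficient of \<open>\<tau> = \<sigma> - {v}\<close> in \<open>\<partial>c\<close> gives the formula below, since the
  vertices below \<open>v\<close> in \<open>\<sigma>\<close> and in \<open>\<tau>\<close> are the same.
\<close>

definition boundary_map :: "'a set set \<Rightarrow> ('a set \<Rightarrow> 'k::field) \<Rightarrow> 'a set \<Rightarrow> 'k" where
  "boundary_map \<Delta> c \<tau> =
     (\<Sum>v | v \<notin> \<tau> \<and> insert v \<tau> \<in> \<Delta>. (-1) ^ card {w\<in>\<tau>. vertex_less w v} * c (insert v \<tau>))"

definition cycle_group :: "int \<Rightarrow> 'a set set \<Rightarrow> ('a set \<Rightarrow> 'k::field) monoid" where
  "cycle_group i \<Delta> =
     (chain_group i \<Delta>)\<lparr>carrier := kernel (chain_group i \<Delta>) (chain_group (i - 1) \<Delta>) (boundary_map \<Delta>)\<rparr>"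

definition boundaries :: "int \<Rightarrow> 'a set set \<Rightarrow> ('a set \<Rightarrow> 'k::field) set" where
  "boundaries i \<Delta> = boundary_map \<Delta> ` carrier (chain_group (i + 1) \<Delta>)"

definition reduced_homology :: "int \<Rightarrow> 'a set set \<Rightarrow> ('a set \<Rightarrow> 'k::field) set monoid" where
  "reduced_homology i \<Delta> = cycle_group i \<Delta> Mod boundaries i \<Delta>"

text \<open>The argument \<open>TYPE('k)\<close> only carries the coefficient field.\<close>

definition acyclic_complex :: "'k::field itself \<Rightarrow> 'a set set \<Rightarrow> bool" where
  "acyclic_complex _ \<Delta> \<longleftrightarrow>
     (\<forall>i. trivial_group (reduced_homology i \<Delta> :: ('a set \<Rightarrow> 'k) set monoid))"

definition fold_acyclic :: "'k::field itself \<Rightarrow> nat \<Rightarrow> 'a set set \<Rightarrow> bool" where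
  "fold_acyclic K k \<Delta> \<longleftrightarrow> (\<forall>\<sigma>\<in>\<Delta>. card \<sigma> < k \<longrightarrow> acyclic_complex K (link \<Delta> \<sigma>))"


section \<open>Boolean intervals\<close>

text \<open>
  A poset is given by its underlying set, ordered by the order of the type; for sets of faces this
  is inclusion.
\<close>

definition poset_interval :: "'p::order set \<Rightarrow> 'p \<Rightarrow> 'p \<Rightarrow> 'p set" where
  "poset_interval P x y = {z\<in>P. x \<le> z \<and> z \<le> y}"

definition poset_isomorphic :: "'p::order set \<Rightarrow> 'q::order set \<Rightarrow> bool" where
  "poset_isomorphic P Q \<longleftrightarrow>
     (\<exists>f. bij_betw f P Q \<and> (\<forall>x\<in>P. \<forall>y\<in>P. x \<le> y \<longleftrightarrow> f x \<le> f y))"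

definition boolean_interval :: "nat \<Rightarrow> 'p::order set \<Rightarrow> 'p set \<Rightarrow> bool" where
  "boolean_interval k P I \<longleftrightarrow>
     (\<exists>x\<in>P. \<exists>y\<in>P. I = poset_interval P x y) \<and> poset_isomorphic I (Pow {1..k})"

definition minimal_elements :: "'p::order set \<Rightarrow> 'p set" where
  "minimal_elements I = {x\<in>I. \<forall>z\<in>I. \<not> z < x}"

end

theory Submission
  imports Complex_Main Defs "HOL-Library.Function_Algebras"
    "HOL-Computational_Algebra.Formal_Power_Series"
begin

text \<open>
  The complex turns out to be built like a tree. Start with one facet, and glue on the others one
  at a time, each along a \<open>d\<close>-element face \<open>G\<close> of what is there already, and each bringing exactly
  one new vertex \<open>v\<close>. The faces gained by gluing on \<open>insert v G\<close> are those that contain \<open>v\<close>, which form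
  the boolean interval \<open>{{v}..insert v G}\<close> of rank \<open>d\<close>. The first facet \<open>insert v G\<close> is itself the union of
  the intervals \<open>{{}..G}\<close> and \<open>{{v}..insert v G}\<close>. All minimal faces are therefore empty or single
  vertices, and with the empty face among them they form a subcomplex.

  Two consequences of \<open>d\<close>-fold acyclicity make this work. The first is connectedness: any two facets
  are joined by a sequence of facets in which neighbours share at least \<open>d\<close> vertices
  (\<open>facets_connected\<close>). This goes by induction on \<open>d\<close>. Facets with a common vertex are joined inside
  the link of that vertex, and vertices are joined by edges because the complex is acyclic. It also
  forces all facets to have \<open>d + 1\<close> vertices (\<open>facets_eq_top_faces\<close>), so every facet can be glued on
  along a \<open>d\<close>-element face, at the cost of at most one new vertex.

  The second is a count: there are exactly \<open>d\<close> more vertices than facets (\<open>card_vertices_eq\<close>). The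
  Euler characteristics of the links of all faces with fewer than \<open>d\<close> elements vanish. Hence, if
  \<open>f\<^sub>i\<close> is the number of faces with \<open>i\<close> elements, the polynomial \<open>\<Sum>\<^sub>i f\<^sub>i t^i\<close> is divisible by
  \<open>(1 + t)^d\<close>. It has degree \<open>d + 1\<close> and constant term 1, so it is \<open>(1 + t)^d (1 + a t)\<close>, and comparing
  coefficients gives \<open>f\<^sub>1 = d + a\<close> and \<open>f\<^sub>d\<^sub>+\<^sub>1 = a\<close>. Since the first facet has \<open>d + 1\<close> vertices and each
  further one adds at most one, the count leaves no room for a gluing step without a new vertex.
\<close>

section \<open>Rank and nullity\<close>

lemma (in Vector_Spaces.linear) dim_kernel_add_dim_image:
  assumes W: "vs1.subspace W" and B: "finite B" "W \<subseteq> vs1.span B"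
  shows "vs1.dim {x\<in>W. f x = 0} + vs2.dim (f ` W) = vs1.dim W"
proof -
  interpret p: vector_space_pair s1 s2 by unfold_locales
  interpret q: vector_space_pair s1 s1 by unfold_locales
  have lin: "Vector_Spaces.linear s1 s2 f" by unfold_locales
  let ?K = "{x\<in>W. f x = 0}"
  obtain K where K: "K \<subseteq> ?K" "vs1.independent K" "?K \<subseteq> vs1.span K" "card K = vs1.dim ?K"
    using vs1.basis_exists[of ?K] by blast
  obtain C where C: "K \<subseteq> C" "C \<subseteq> W" "vs1.independent C" "W \<subseteq> vs1.span C"
    using vs1.maximal_independent_subset_extend[of K W] K by blast
  have finC: "finite C"
    using vs1.independent_span_bound[OF B(1) C(3)] C(2) B(2) by blast
  have spC: "vs1.span (C - K) \<subseteq> W"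
    by (rule vs1.span_minimal[OF _ W]) (use C(2) in blast)
  \<comment> \<open>the projection onto the span of \<open>K\<close> shows that this span meets that of \<open>C - K\<close> in zero only\<close>
  obtain g where g: "Vector_Spaces.linear s1 s1 g" "\<forall>x\<in>C. g x = (if x \<in> K then x else 0)"
    using q.linear_independent_extend[OF C(3), of "\<lambda>x. if x \<in> K then x else 0"] by blast
  have g0: "g x = 0" if "x \<in> vs1.span (C - K)" for x
    by (rule q.linear_eq_0_on_span[OF g(1) _ that]) (use g(2) in auto)
  have g1: "g x = x" if "x \<in> vs1.span K" for x
    by (rule q.linear_eq_on_span[OF g(1) vs1.linear_ident _ that]) (use g(2) C(1) in auto)
  have inj: "inj_on f (vs1.span (C - K))"
  proof (subst inj_on_iff_eq_0[OF vs1.subspace_span], intro ballI impI)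
    fix x assume x: "x \<in> vs1.span (C - K)" "f x = 0"
    then have "x \<in> ?K" using spC by blast
    then have "x \<in> vs1.span K" using K(3) by blast
    then show "x = 0" using g0[OF x(1)] g1 by simp
  qed
  have ind: "vs2.independent (f ` (C - K))"
    using p.linear_independent_injective_image[OF lin _ inj] C(3) vs1.independent_mono by blast
  have "f ` W \<subseteq> f ` vs1.span C" using C(4) by blast
  also have "\<dots> = vs2.span (f ` C)" using span_image by simp
  also have "\<dots> \<subseteq> vs2.span (f ` (C - K))"
  proof (rule vs2.span_minimal)
    show "f ` C \<subseteq> vs2.span (f ` (C - K))"
    proof
      fix y assume "y \<in> f ` C"
      then obtain x where x: "x \<in> C" "y = f x" by blast
      show "y \<in> vs2.span (f ` (C - K))"
      proof (cases "x \<in> K")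
        case True
        then have "y = 0" using K(1) x by blast
        then show ?thesis by (simp add: vs2.span_zero)
      next
        case False then show ?thesis using x by (auto intro: vs2.span_base)
      qed
    qed
  qed (rule vs2.subspace_span)
  finally have "card (f ` (C - K)) = vs2.dim (f ` W)"
    using C(2) ind by (intro vs2.basis_card_eq_dim) auto
  moreover have "card (f ` (C - K)) = card (C - K)"
    by (rule card_image[OF inj_on_subset[OF inj vs1.span_superset]])
  moreover have "card C = vs1.dim W" using C by (intro vs1.basis_card_eq_dim)
  moreover have "card C = card K + card (C - K)"
    using C(1) finC by (simp add: card_Diff_subset card_mono finite_subset)
  ultimately show ?thesis using K(4) by simp
qed

abbreviation (input) scale_fun :: "'k::field \<Rightarrow> ('x \<Rightarrow> 'k) \<Rightarrow> 'x \<Rightarrow> 'k" where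
  "scale_fun a f \<equiv> (\<lambda>x. a * f x)"

interpretation fun_space: vector_space scale_fun
  by unfold_locales (auto simp: fun_eq_iff algebra_simps)

abbreviation functions_on :: "'x set \<Rightarrow> ('x \<Rightarrow> 'k::field) set" where
  "functions_on A \<equiv> {f. \<forall>x. f x \<noteq> 0 \<longrightarrow> x \<in> A}"

lemma subspace_functions_on: "fun_space.subspace (functions_on A)"
  by (rule fun_space.subspaceI) (auto, metis add.right_neutral)

lemma sum_fun_apply: "(\<Sum>i\<in>I. f i) x = (\<Sum>i\<in>I. f i x :: 'b::comm_monoid_add)"
  by (induction I rule: infinite_finite_induct) auto

text \<open>
  The chains of a complex in one degree are the functions on its faces in that degree; the indicator
  functions of single faces are the basis that makes their dimension the number of faces.
\<close>

lemma functions_on_basis: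
  fixes A :: "'x set"
  assumes "finite A"
  defines "D \<equiv> (\<lambda>a x. if x = a then 1 else 0 :: 'k::field) ` A"
  shows "fun_space.independent D" "functions_on A \<subseteq> fun_space.span D" "card D = card A"
    "D \<subseteq> functions_on A"
proof -
  let ?e = "\<lambda>a x. if x = a then 1 else 0 :: 'k"
  have inj: "inj_on ?e A" by (rule inj_onI) (metis zero_neq_one)
  then show "card D = card A" unfolding D_def by (rule card_image)
  show "D \<subseteq> functions_on A" unfolding D_def by (auto split: if_splits)
  have finD: "finite D" using assms by simp
  show "fun_space.independent D"
  proof (rule fun_space.independent_if_scalars_zero[OF finD])
    fix f d assume s: "(\<Sum>b\<in>D. scale_fun (f b) b) = 0" and "d \<in> D"
    then obtain a where a: "a \<in> A" "d = ?e a" unfolding D_def by blast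
    have "0 = (\<Sum>b\<in>D. scale_fun (f b) b) a" using s by simp
    also have "\<dots> = (\<Sum>b\<in>A. f (?e b) * ?e b a)"
      unfolding sum_fun_apply D_def by (subst sum.reindex[OF inj]) simp
    also have "\<dots> = (\<Sum>b\<in>A. if b = a then f (?e b) else 0)" by (rule sum.cong) auto
    also have "\<dots> = f d" using a assms by simp
    finally show "f d = 0" by simp
  qed
  show "functions_on A \<subseteq> fun_space.span D"
  proof
    fix f :: "'x \<Rightarrow> 'k" assume f: "f \<in> functions_on A"
    have "f = (\<Sum>a\<in>A. scale_fun (f a) (?e a))"
    proof
      fix x
      have "(\<Sum>a\<in>A. scale_fun (f a) (?e a)) x = (\<Sum>a\<in>A. if a = x then f a else 0)"
        unfolding sum_fun_apply by (rule sum.cong) auto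
      then show "f x = (\<Sum>a\<in>A. scale_fun (f a) (?e a)) x" using f assms by auto
    qed
    moreover have "(\<Sum>a\<in>A. scale_fun (f a) (?e a)) \<in> fun_space.span D"
      unfolding D_def
      by (intro fun_space.span_sum fun_space.span_scale fun_space.span_base) auto
    ultimately show "f \<in> fun_space.span D" by simp
  qed
qed

lemma dim_functions_on:
  assumes "finite A"
  shows "fun_space.dim (functions_on A :: ('x \<Rightarrow> 'k::field) set) = card A"
  using fun_space.basis_card_eq_dim[OF functions_on_basis(4,2,1)[OF assms]]
  unfolding functions_on_basis(3)[OF assms] by (rule sym)

section \<open>The boundary map\<close>

lemma vertex_less_asym:
  fixes v w :: 'a
  assumes "v \<noteq> w" shows "vertex_less v w \<longleftrightarrow> \<not> vertex_less w v"
proof -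
  from well_ordering obtain r :: "'a rel" where "Well_order r" "Field r = UNIV"
    by (elim exE conjE)
  then have "linear_order_on UNIV r" by (simp add: well_order_on_def)
  then have lin: "linear_order_on UNIV (vertex_order :: 'a rel)"
    unfolding vertex_order_def by (rule someI)
  have "(v, w) \<in> vertex_order \<or> (w, v) \<in> vertex_order"
    using lin assms by (auto simp: linear_order_on_def total_on_def)
  moreover have "\<not> ((v, w) \<in> vertex_order \<and> (w, v) \<in> vertex_order)"
    using lin assms unfolding linear_order_on_def partial_order_on_def by (auto dest: antisymD)
  ultimately show ?thesis using assms unfolding vertex_less_def by auto
qed

text \<open>
  In characteristic 2 the sum being its own negative proves nothing, so the pairs are split by the
  vertex order and each is cancelled against its mirror image. Both uses of the signs of the boundary
  map, that its square is zero and that a boundary has coefficient sum zero on every connected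
  component, reduce to this cancellation.
\<close>

lemma sum_antisymmetric:
  fixes g :: "'a \<Rightarrow> 'a \<Rightarrow> 'k::field"
  assumes "finite R" "sym R" "\<And>v w. (v, w) \<in> R \<Longrightarrow> v \<noteq> w"
    and "\<And>v w. (v, w) \<in> R \<Longrightarrow> g v w = - g w v"
  shows "(\<Sum>(v, w)\<in>R. g v w) = 0"
proof -
  let ?L = "{(v, w)\<in>R. vertex_less v w}" and ?U = "{(v, w)\<in>R. vertex_less w v}"
  have R: "R = ?L \<union> ?U" "?L \<inter> ?U = {}" using assms(3) vertex_less_asym by fast+
  have fin: "finite ?L" "finite ?U" using assms(1) by (auto intro: finite_subset)
  have "(\<Sum>(v, w)\<in>?U. g v w) = (\<Sum>(v, w)\<in>?L. g w v)"
    using symD[OF assms(2)] by (intro sum.reindex_bij_witness[of _ prod.swap prod.swap]) auto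
  also have "\<dots> = (\<Sum>(v, w)\<in>?L. - g v w)"
  proof (rule sum.cong[OF refl], clarify)
    fix v w assume "(v, w) \<in> R"
    then show "g w v = - g v w" using assms(4) symD[OF assms(2)] by blast
  qed
  finally have "(\<Sum>(v, w)\<in>?U. g v w) = - (\<Sum>(v, w)\<in>?L. g v w)"
    by (simp add: sum_negf case_prod_unfold)
  then show ?thesis using sum.union_disjoint[OF fin R(2), of "\<lambda>(v, w). g v w"] R(1) by simp
qed

lemma simplicial_complexD:
  assumes "simplicial_complex \<Delta>"
  shows "finite \<Delta>" "{} \<in> \<Delta>" "\<sigma> \<in> \<Delta> \<Longrightarrow> finite \<sigma>" "\<sigma> \<in> \<Delta> \<Longrightarrow> \<tau> \<subseteq> \<sigma> \<Longrightarrow> \<tau> \<in> \<Delta>" "finite (\<Union>\<Delta>)"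
proof -
  have *: "\<Delta> \<noteq> {}" "\<exists>V. finite V \<and> \<Delta> \<subseteq> Pow V"
    and down: "\<And>\<sigma> \<tau>. \<sigma> \<in> \<Delta> \<Longrightarrow> \<tau> \<subseteq> \<sigma> \<Longrightarrow> \<tau> \<in> \<Delta>"
    using assms unfolding simplicial_complex_def by simp_all
  from *(2) obtain V where V: "finite V" "\<Delta> \<subseteq> Pow V" by auto
  show "finite \<Delta>" using V(1) by (intro finite_subset[OF V(2)]) simp
  show "{} \<in> \<Delta>" using *(1) down[OF _ empty_subsetI] by auto
  show "\<sigma> \<in> \<Delta> \<Longrightarrow> finite \<sigma>" using V(2) by (intro finite_subset[OF _ V(1)]) auto
  show "\<sigma> \<in> \<Delta> \<Longrightarrow> \<tau> \<subseteq> \<sigma> \<Longrightarrow> \<tau> \<in> \<Delta>" by (rule down)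
  show "finite (\<Union>\<Delta>)" by (rule finite_subset[OF _ V(1)]) (use V(2) in blast)
qed

lemma finite_cofaces: "simplicial_complex \<Delta> \<Longrightarrow> finite {v. v \<notin> \<tau> \<and> insert v \<tau> \<in> \<Delta>}"
  by (rule finite_subset[OF _ simplicial_complexD(5)]) auto

text \<open>
  The index counts the elements of a face, so it exceeds the dimension by one; degrees below that of
  the empty face carry only the zero chain.
\<close>

definition simplicial_chains :: "nat \<Rightarrow> 'a set set \<Rightarrow> ('a set \<Rightarrow> 'k::field) set" where
  "simplicial_chains n \<Delta> = functions_on {\<sigma>\<in>\<Delta>. card \<sigma> = n}"

lemma linear_boundary_map: "Vector_Spaces.linear scale_fun scale_fun
    (boundary_map \<Delta> :: ('a set \<Rightarrow> 'k::field) \<Rightarrow> 'a set \<Rightarrow> 'k)"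
  unfolding Vector_Spaces.linear_iff
proof (intro conjI allI)
  show "boundary_map \<Delta> (c + c') = boundary_map \<Delta> c + boundary_map \<Delta> c'" for c c' :: "'a set \<Rightarrow> 'k"
    by (rule ext) (simp add: boundary_map_def ring_distribs sum.distrib)
  show "boundary_map \<Delta> (scale_fun a c) = scale_fun a (boundary_map \<Delta> c)" for a and c :: "'a set \<Rightarrow> 'k"
    by (rule ext) (simp add: boundary_map_def sum_distrib_left mult.left_commute)
qed (rule fun_space.vector_space_axioms)+

lemma boundary_map_in_chains:
  assumes "simplicial_complex \<Delta>" "c \<in> simplicial_chains (Suc n) \<Delta>"
  shows "boundary_map \<Delta> c \<in> simplicial_chains n \<Delta>"
  unfolding simplicial_chains_def
proof (intro CollectI allI impI)
  fix \<tau> assume "boundary_map \<Delta> c \<tau> \<noteq> 0"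
  then obtain v where v: "v \<notin> \<tau>" "insert v \<tau> \<in> \<Delta>" "c (insert v \<tau>) \<noteq> 0"
    unfolding boundary_map_def by (metis (no_types, lifting) mem_Collect_eq mult_zero_right sum.neutral)
  have "\<tau> \<in> \<Delta>" "finite \<tau>" using simplicial_complexD(3,4)[OF assms(1)] v(2) by blast+
  then show "\<tau> \<in> \<Delta> \<and> card \<tau> = n" using v assms(2) unfolding simplicial_chains_def by auto
qed

lemma boundary_map_boundary_map:
  fixes c :: "'a set \<Rightarrow> 'k::field"
  assumes \<Delta>: "simplicial_complex \<Delta>" and "c \<in> simplicial_chains n \<Delta>"
  shows "boundary_map \<Delta> (boundary_map \<Delta> c) = 0"
proof
  fix \<tau> :: "'a set"
  show "boundary_map \<Delta> (boundary_map \<Delta> c) \<tau> = 0 \<tau>"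
  proof (cases "finite \<tau>")
    case False
    then have "{v. v \<notin> \<tau> \<and> insert v \<tau> \<in> \<Delta>} = {}" using simplicial_complexD(3)[OF \<Delta>] by fastforce
    then show ?thesis unfolding boundary_map_def zero_fun_apply by (simp only: sum.empty)
  next
    case True
    define s where "s = (\<lambda>v. (-1) ^ card {w\<in>\<tau>. vertex_less w v} :: 'k)"
    define \<epsilon> where "\<epsilon> = (\<lambda>v w :: 'a. if vertex_less v w then -1 else 1 :: 'k)"
    define g where "g = (\<lambda>v w. s v * s w * \<epsilon> v w * c (insert v (insert w \<tau>)))"
    define X where "X = {v. v \<notin> \<tau> \<and> insert v \<tau> \<in> \<Delta>}"
    define Y where "Y = (\<lambda>v. {w. w \<notin> insert v \<tau> \<and> insert w (insert v \<tau>) \<in> \<Delta>})"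
    \<comment> \<open>inserting \<open>v\<close> shifts the position of \<open>w\<close> by one exactly if \<open>v\<close> precedes \<open>w\<close>; this sign
      \<open>\<epsilon>\<close> is the only part of a summand that is not symmetric in \<open>v\<close> and \<open>w\<close>\<close>
    have sgn: "(-1) ^ card {u\<in>insert v \<tau>. vertex_less u w} = s w * \<epsilon> v w" if "v \<notin> \<tau>" for v w
    proof (cases "vertex_less v w")
      case True
      then have "{u\<in>insert v \<tau>. vertex_less u w} = insert v {u\<in>\<tau>. vertex_less u w}" by auto
      then show ?thesis using True that \<open>finite \<tau>\<close> by (simp add: s_def \<epsilon>_def)
    next
      case False
      then have "{u\<in>insert v \<tau>. vertex_less u w} = {u\<in>\<tau>. vertex_less u w}" by auto
      then show ?thesis using False by (simp add: s_def \<epsilon>_def)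
    qed
    have fin: "finite X" "finite (Y v)" for v
      unfolding X_def Y_def by (rule finite_cofaces[OF \<Delta>])+
    have "boundary_map \<Delta> (boundary_map \<Delta> c) \<tau> = (\<Sum>v\<in>X. s v * (\<Sum>w\<in>Y v.
        (-1) ^ card {u\<in>insert v \<tau>. vertex_less u w} * c (insert w (insert v \<tau>))))"
      unfolding boundary_map_def X_def Y_def s_def by simp
    also have "\<dots> = (\<Sum>v\<in>X. \<Sum>w\<in>Y v. g v w)"
      unfolding sum_distrib_left
      by (intro sum.cong refl) (simp add: X_def sgn g_def insert_commute mult.assoc del: insert_iff)
    also have "\<dots> = (\<Sum>(v, w)\<in>Sigma X Y. g v w)"
      using fin by (intro sum.Sigma) auto
    also have "\<dots> = 0"
    proof (rule sum_antisymmetric)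
      show "finite (Sigma X Y)" using fin by auto
      show "sym (Sigma X Y)"
      proof (rule symI)
        fix v w assume "(v, w) \<in> Sigma X Y"
        then have "w \<notin> insert v \<tau>" "insert w (insert v \<tau>) \<in> \<Delta>" "v \<notin> \<tau>"
          unfolding X_def Y_def by auto
        moreover from this(2) have "insert w \<tau> \<in> \<Delta>"
          by (rule simplicial_complexD(4)[OF \<Delta>]) blast
        ultimately show "(w, v) \<in> Sigma X Y" unfolding X_def Y_def by (auto simp: insert_commute)
      qed
      show "v \<noteq> w" if "(v, w) \<in> Sigma X Y" for v w using that by (auto simp: Y_def)
      then show "g v w = - g w v" if "(v, w) \<in> Sigma X Y" for v w
        using that vertex_less_asym[of v w] by (auto simp: g_def \<epsilon>_def insert_commute)
    qed
    finally show ?thesis by simp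
  qed
qed

section \<open>Acyclic complexes\<close>

lemma chains_eq_carrier: "simplicial_chains n \<Delta> = carrier (chain_group (int n - 1) \<Delta>)"
  unfolding simplicial_chains_def chain_group_def face_dim_def by auto

text \<open>
  Triviality of the quotient says that the coset of every cycle is the group of boundaries itself;
  the coset contains the cycle since zero is a boundary.
\<close>

lemma acyclic_cycle_is_boundary:
  fixes c :: "'a set \<Rightarrow> 'k::field"
  assumes acyc: "acyclic_complex TYPE('k) \<Delta>" and c: "c \<in> simplicial_chains n \<Delta>" "boundary_map \<Delta> c = 0"
  shows "c \<in> boundary_map \<Delta> ` simplicial_chains (Suc n) \<Delta>"
proof -
  define i where "i = int n - 1"
  let ?Z = "cycle_group i \<Delta> :: ('a set \<Rightarrow> 'k) monoid"
  let ?B = "boundaries i \<Delta> :: ('a set \<Rightarrow> 'k) set"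
  have B: "?B = boundary_map \<Delta> ` simplicial_chains (Suc n) \<Delta>"
    unfolding boundaries_def chains_eq_carrier i_def by simp
  have "c \<in> carrier ?Z"
    using c unfolding cycle_group_def kernel_def chains_eq_carrier i_def
    by (simp add: chain_group_def zero_fun_def)
  then have "?B #>\<^bsub>?Z\<^esub> c \<in> carrier (?Z Mod ?B)"
    unfolding FactGroup_def RCOSETS_def by auto
  also have "carrier (?Z Mod ?B) = {?B}"
    using acyc unfolding acyclic_complex_def trivial_group_def reduced_homology_def FactGroup_def
    by (metis monoid.select_convs(2))
  finally have eq: "?B #>\<^bsub>?Z\<^esub> c = ?B" by simp
  have "boundary_map \<Delta> (0 :: 'a set \<Rightarrow> 'k) = 0"
    by (simp add: boundary_map_def fun_eq_iff)
  moreover have "(0 :: 'a set \<Rightarrow> 'k) \<in> simplicial_chains (Suc n) \<Delta>" by (simp add: simplicial_chains_def)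
  ultimately have "(0 :: 'a set \<Rightarrow> 'k) \<in> ?B" unfolding B by (metis imageI)
  then have "0 \<otimes>\<^bsub>?Z\<^esub> c \<in> ?B #>\<^bsub>?Z\<^esub> c" unfolding r_coset_def by blast
  moreover have "0 \<otimes>\<^bsub>?Z\<^esub> c = c" by (simp add: cycle_group_def chain_group_def)
  ultimately show ?thesis using eq B by simp
qed

text \<open>
  Exactness makes the number of faces in each degree the sum of two consecutive ranks of the boundary
  map, so the alternating sum telescopes.
\<close>

lemma acyclic_euler_characteristic:
  assumes \<Delta>: "simplicial_complex \<Delta>" and acyc: "acyclic_complex TYPE('k::field) \<Delta>"
  shows "(\<Sum>\<sigma>\<in>\<Delta>. (-1) ^ card \<sigma>) = (0::'b::comm_ring_1)"
proof -
  interpret bd: Vector_Spaces.linear scale_fun scale_fun "boundary_map \<Delta> :: ('a set \<Rightarrow> 'k) \<Rightarrow> _"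
    by (rule linear_boundary_map)
  define C :: "nat \<Rightarrow> ('a set \<Rightarrow> 'k) set" where "C = (\<lambda>n. simplicial_chains n \<Delta>)"
  define r where "r n = fun_space.dim (boundary_map \<Delta> ` C n)" for n
  define f where "f n = card {\<sigma>\<in>\<Delta>. card \<sigma> = n}" for n
  define N where "N = Suc (Max (card ` \<Delta>))"
  note fin = simplicial_complexD(1)[OF \<Delta>]
  have le_N: "card \<sigma> < N" if "\<sigma> \<in> \<Delta>" for \<sigma>
    using that fin unfolding N_def by (simp add: less_Suc_eq_le)
  have f_eq: "f n = r (Suc n) + r n" for n
  proof -
    have "{c \<in> C n. boundary_map \<Delta> c = 0} = boundary_map \<Delta> ` C (Suc n)"
      using acyclic_cycle_is_boundary[OF acyc] boundary_map_boundary_map[OF \<Delta>]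
        boundary_map_in_chains[OF \<Delta>] unfolding C_def by blast
    moreover have "fun_space.dim {c \<in> C n. boundary_map \<Delta> c = 0} + r n = fun_space.dim (C n)"
      unfolding r_def C_def simplicial_chains_def
      by (rule bd.dim_kernel_add_dim_image[OF subspace_functions_on _ functions_on_basis(2)])
        (use fin in auto)
    moreover have "fun_space.dim (C n) = f n"
      unfolding C_def simplicial_chains_def f_def using fin by (intro dim_functions_on) auto
    ultimately show ?thesis unfolding r_def by simp
  qed
  have dim0: "fun_space.dim {0 :: 'a set \<Rightarrow> 'k} = 0"
    by (metis fun_space.dim_span fun_space.span_empty fun_space.independent_empty
        fun_space.dim_eq_card_independent card.empty)
  have "boundary_map \<Delta> c = 0" if "c \<in> C 0" for c
  proof -
    have "c (insert v \<tau>) = 0" if "insert v \<tau> \<in> \<Delta>" for v \<tau>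
      using \<open>c \<in> C 0\<close> simplicial_complexD(3)[OF \<Delta> that] unfolding C_def simplicial_chains_def by fastforce
    then show ?thesis unfolding boundary_map_def fun_eq_iff by simp
  qed
  then have "boundary_map \<Delta> ` C 0 = {0}"
    unfolding C_def simplicial_chains_def by (force simp: image_def)
  then have r0: "r 0 = 0" using dim0 unfolding r_def by simp
  have "C N = {0}" using le_N unfolding C_def simplicial_chains_def by (force simp: fun_eq_iff)
  then have rN: "r N = 0" using dim0 unfolding r_def by simp
  have "(\<Sum>\<sigma>\<in>\<Delta>. (-1) ^ card \<sigma>) = (\<Sum>n<N. \<Sum>\<sigma>\<in>{\<sigma>\<in>\<Delta>. card \<sigma> = n}. (-1) ^ card \<sigma> :: 'b)"
    using le_N fin by (intro sum.group[symmetric]) auto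
  also have "\<dots> = (\<Sum>n<N. (-1) ^ n * of_nat (f n))"
    by (intro sum.cong refl) (simp add: f_def mult.commute)
  also have "\<dots> = (\<Sum>n<N. (-1) ^ n * of_nat (r n) - (-1) ^ Suc n * of_nat (r (Suc n)))"
    by (simp add: f_eq algebra_simps)
  also have "\<dots> = (-1) ^ 0 * of_nat (r 0) - (-1) ^ N * of_nat (r N)"
    by (rule sum_lessThan_telescope')
  finally show ?thesis using r0 rN by simp
qed

section \<open>Counting faces\<close>

lemma simplicial_complex_link:
  assumes "simplicial_complex \<Delta>" "\<sigma> \<in> \<Delta>"
  shows "simplicial_complex (link \<Delta> \<sigma>)"
  unfolding simplicial_complex_def
proof (intro conjI ballI allI impI)
  note \<Delta> = simplicial_complexD[OF assms(1)]
  show "link \<Delta> \<sigma> \<noteq> {}" using \<Delta>(2) assms(2) unfolding link_def by force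
  show "\<exists>V. finite V \<and> link \<Delta> \<sigma> \<subseteq> Pow V"
    using \<Delta>(5) unfolding link_def by (intro exI[of _ "\<Union>\<Delta>"]) auto
  fix \<rho> \<tau> assume \<rho>: "\<rho> \<in> link \<Delta> \<sigma>" and "\<tau> \<subseteq> \<rho>"
  then have "\<tau> \<subseteq> \<rho>" "\<tau> \<union> \<sigma> \<subseteq> \<rho> \<union> \<sigma>" by auto
  then show "\<tau> \<in> link \<Delta> \<sigma>" using \<rho> \<Delta>(4) unfolding link_def by blast
qed

text \<open>
  Summing the Euler characteristics of the links of all \<open>j\<close>-element faces counts every face \<open>\<rho>\<close> once
  for each of its \<open>j\<close>-element subsets. The identity says that the \<open>j\<close>-th derivative of the polynomial
  \<open>\<Sum>\<^sub>i f\<^sub>i t^i\<close> vanishes at \<open>-1\<close>.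
\<close>

lemma sum_binomial_eq_0:
  assumes \<Delta>: "simplicial_complex \<Delta>" and acyc: "fold_acyclic TYPE('k::field) d \<Delta>" and "j < d"
  shows "(\<Sum>\<rho>\<in>\<Delta>. (-1) ^ card \<rho> * of_nat (card \<rho> choose j)) = (0::'b::comm_ring_1)"
proof -
  note \<Delta>' = simplicial_complexD[OF \<Delta>]
  let ?\<Delta>j = "{\<sigma>\<in>\<Delta>. card \<sigma> = j}"
  have "(\<Sum>\<rho>\<in>\<Delta>. (-1) ^ card \<rho> * of_nat (card \<rho> choose j)) =
      (\<Sum>\<rho>\<in>\<Delta>. \<Sum>\<sigma>\<in>{\<sigma>\<in>?\<Delta>j. \<sigma> \<subseteq> \<rho>}. (-1) ^ card \<rho> :: 'b)"
  proof (rule sum.cong[OF refl])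
    fix \<rho> assume \<rho>: "\<rho> \<in> \<Delta>"
    have "{\<sigma>\<in>?\<Delta>j. \<sigma> \<subseteq> \<rho>} = {\<sigma>. \<sigma> \<subseteq> \<rho> \<and> card \<sigma> = j}" using \<Delta>'(4)[OF \<rho>] by auto
    then have "card {\<sigma>\<in>?\<Delta>j. \<sigma> \<subseteq> \<rho>} = card \<rho> choose j" using n_subsets[OF \<Delta>'(3)[OF \<rho>]] by simp
    then show "(-1) ^ card \<rho> * of_nat (card \<rho> choose j) = (\<Sum>\<sigma>\<in>{\<sigma>\<in>?\<Delta>j. \<sigma> \<subseteq> \<rho>}. (-1) ^ card \<rho> :: 'b)"
      by (simp add: mult.commute)
  qed
  also have "\<dots> = (\<Sum>\<sigma>\<in>?\<Delta>j. \<Sum>\<rho>\<in>{\<rho>\<in>\<Delta>. \<sigma> \<subseteq> \<rho>}. (-1) ^ card \<rho>)"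
    using \<Delta>'(1) by (intro sum.swap_restrict) auto
  also have "\<dots> = (\<Sum>\<sigma>\<in>?\<Delta>j. 0)"
  proof (rule sum.cong[OF refl])
    fix \<sigma> assume "\<sigma> \<in> ?\<Delta>j"
    then have \<sigma>: "\<sigma> \<in> \<Delta>" "card \<sigma> = j" by auto
    have "(\<Sum>\<rho>\<in>{\<rho>\<in>\<Delta>. \<sigma> \<subseteq> \<rho>}. (-1) ^ card \<rho> :: 'b) = (\<Sum>\<tau>\<in>link \<Delta> \<sigma>. (-1) ^ j * (-1) ^ card \<tau>)"
    proof (rule sum.reindex_bij_witness[of _ "\<lambda>\<tau>. \<tau> \<union> \<sigma>" "\<lambda>\<rho>. \<rho> - \<sigma>"])
      fix \<rho> assume "\<rho> \<in> {\<rho>\<in>\<Delta>. \<sigma> \<subseteq> \<rho>}"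
      then have \<rho>: "\<rho> \<in> \<Delta>" "\<sigma> \<subseteq> \<rho>" by auto
      then show "\<rho> - \<sigma> \<union> \<sigma> = \<rho>" by auto
      then show "\<rho> - \<sigma> \<in> link \<Delta> \<sigma>" using \<Delta>'(4)[OF \<rho>(1), of "\<rho> - \<sigma>"] \<rho>(1) unfolding link_def by auto
      have "card \<rho> = j + card (\<rho> - \<sigma>)"
        using card_Diff_subset[of \<sigma> \<rho>] card_mono[OF \<Delta>'(3) \<rho>(2)] \<Delta>'(3) \<rho> \<sigma> by simp
      then show "(-1) ^ j * (-1) ^ card (\<rho> - \<sigma>) = ((-1) ^ card \<rho> :: 'b)" by (simp add: power_add)
    qed (auto simp: link_def)
    also have "\<dots> = (-1) ^ j * (\<Sum>\<tau>\<in>link \<Delta> \<sigma>. (-1) ^ card \<tau>)" by (rule sum_distrib_left[symmetric])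
    also have "(\<Sum>\<tau>\<in>link \<Delta> \<sigma>. (-1) ^ card \<tau>) = (0::'b)"
      using acyclic_euler_characteristic[OF simplicial_complex_link[OF \<Delta> \<sigma>(1)], where 'k = 'k]
        acyc \<sigma> \<open>j < d\<close> unfolding fold_acyclic_def by blast
    finally show "(\<Sum>\<rho>\<in>{\<rho>\<in>\<Delta>. \<sigma> \<subseteq> \<rho>}. (-1) ^ card \<rho>) = (0::'b)" by simp
  qed
  finally show ?thesis by simp
qed

text \<open>
  For \<open>d = 0\<close> the vertices are the largest faces. Otherwise the identities for \<open>j < d\<close> are combined into
  one that weights a face with \<open>i\<close> elements by \<open>(-1)^i\<close> times a polynomial in \<open>i\<close> of degree \<open>d - 1\<close> vanishing at \<open>2, ..., d\<close>, so that only the empty face, the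
  vertices and the largest faces remain. The polynomial is \<open>(i - 2) gchoose (d - 1)\<close>, and the
  Vandermonde identity expands it in the \<open>i choose j\<close> with \<open>j < d\<close>.
\<close>

lemma card_vertices_eq:
  assumes \<Delta>: "simplicial_complex \<Delta>" and acyc: "fold_acyclic TYPE('k::field) d \<Delta>"
    and le: "\<And>\<sigma>. \<sigma> \<in> \<Delta> \<Longrightarrow> card \<sigma> \<le> Suc d"
  shows "card (\<Union>\<Delta>) = d + card {\<sigma>\<in>\<Delta>. card \<sigma> = Suc d}"
proof -
  note \<Delta>' = simplicial_complexD[OF \<Delta>]
  have "{\<sigma>\<in>\<Delta>. card \<sigma> = 1} = (\<lambda>v. {v}) ` \<Union>\<Delta>"
    using \<Delta>'(4) by (auto simp: card_1_singleton_iff)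
  then have V: "card {\<sigma>\<in>\<Delta>. card \<sigma> = 1} = card (\<Union>\<Delta>)" by (simp add: card_image)
  show ?thesis
  proof (cases d)
    case 0 then show ?thesis using V by simp
  next
    case (Suc e)
    \<comment> \<open>the weights at 0, 1 and \<open>d + 1\<close> elements, up to the common sign \<open>(-1) ^ e\<close>\<close>
    have bin: "(-1) ^ card \<rho> * ((of_nat (card \<rho>) - 2 :: rat) gchoose e) =
        (-1) ^ e * ((if card \<rho> = 0 then of_nat d else 0) - (if card \<rho> = 1 then 1 else 0)
          + (if card \<rho> = Suc d then 1 else 0))" if "\<rho> \<in> \<Delta>" for \<rho>
    proof -
      have "card \<rho> = 0 \<or> card \<rho> = 1 \<or> (\<exists>i. card \<rho> = i + 2 \<and> i < e) \<or> card \<rho> = Suc d"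
        using le[OF that] Suc by presburger
      then consider "card \<rho> = 0" | "card \<rho> = 1" | i where "card \<rho> = i + 2" "i < e" | "card \<rho> = Suc d"
        by (elim disjE exE conjE)
      then show ?thesis
      proof cases
        case 1
        have "(-2 :: rat) gchoose e = (-1) ^ e * ((of_nat e + 1) gchoose e)"
          by (subst gbinomial_negated_upper) simp
        also have "(of_nat e + 1 :: rat) = of_nat (Suc e)" by simp
        also have "of_nat (Suc e) gchoose e = (of_nat (Suc e choose e) :: rat)"
          by (rule binomial_gbinomial[symmetric])
        finally show ?thesis using 1 Suc by simp
      next
        case 2
        have "(-1 :: rat) gchoose e = (-1) ^ e * (of_nat e gchoose e)"
          by (subst gbinomial_negated_upper) simp
        then show ?thesis using 2 Suc by (simp flip: binomial_gbinomial)
      next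
        case 3
        then show ?thesis using Suc by (simp flip: binomial_gbinomial)
      next
        case 4
        have "(of_nat (card \<rho>) - 2 :: rat) = of_nat e" using 4 Suc by simp
        then show ?thesis using 4 Suc by (simp flip: binomial_gbinomial)
      qed
    qed
    have "0 = (\<Sum>k\<in>{0..e}. ((-2) gchoose (e - k)) * (\<Sum>\<rho>\<in>\<Delta>. (-1) ^ card \<rho> * of_nat (card \<rho> choose k) :: rat))"
      using Suc by (intro sum.neutral[symmetric] ballI) (subst sum_binomial_eq_0[OF \<Delta> acyc]; simp)
    also have "\<dots> = (\<Sum>\<rho>\<in>\<Delta>. (-1) ^ card \<rho> *
        (\<Sum>k\<in>{0..e}. (of_nat (card \<rho>) gchoose k) * ((-2) gchoose (e - k))))"
      unfolding sum_distrib_left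
      by (subst sum.swap) (simp add: binomial_gbinomial mult_ac)
    also have "\<dots> = (\<Sum>\<rho>\<in>\<Delta>. (-1) ^ card \<rho> * ((of_nat (card \<rho>) - 2) gchoose e))"
      by (subst gbinomial_Vandermonde) simp
    also have "\<dots> = (-1) ^ e * ((\<Sum>\<rho>\<in>\<Delta>. if card \<rho> = 0 then of_nat d else 0)
        - (\<Sum>\<rho>\<in>\<Delta>. if card \<rho> = 1 then 1 else 0) + (\<Sum>\<rho>\<in>\<Delta>. if card \<rho> = Suc d then 1 else 0))"
      by (simp only: bin cong: sum.cong)
        (simp only: sum_distrib_left[symmetric] sum.distrib sum_subtractf)
    also have "(\<Sum>\<rho>\<in>\<Delta>. if card \<rho> = 0 then of_nat d else 0) = (\<Sum>\<rho>\<in>\<Delta>. if \<rho> = {} then of_nat d else (0::rat))"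
      using \<Delta>'(3) by (intro sum.cong) auto
    finally have "of_nat d + of_nat (card {\<sigma>\<in>\<Delta>. card \<sigma> = Suc d}) = (of_nat (card {\<sigma>\<in>\<Delta>. card \<sigma> = 1}) :: rat)"
      using \<Delta>'(1,2) by (simp flip: sum.inter_filter)
    then show ?thesis using V by (simp flip: of_nat_add)
  qed
qed

section \<open>Connectedness\<close>

text \<open>
  If \<open>w\<close> were not reachable from \<open>u\<close>, the cycle \<open>[u] - [w]\<close> would have coefficient sum 1 on the
  vertices reachable from \<open>u\<close>. But it is the boundary of a chain of edges, and the two contributions of
  an edge cancel there, because its ends are both reachable or both not.
\<close>

lemma acyclic_vertices_connected:
  assumes \<Delta>: "simplicial_complex \<Delta>" and acyc: "acyclic_complex TYPE('k::field) \<Delta>"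
    and u: "u \<in> \<Union>\<Delta>" and w: "w \<in> \<Union>\<Delta>"
  shows "(u, w) \<in> {(x, y). {x, y} \<in> \<Delta>}\<^sup>*"
proof (rule ccontr)
  note \<Delta>' = simplicial_complexD[OF \<Delta>]
  let ?E = "{(x, y). {x, y} \<in> \<Delta>}"
  assume not: "(u, w) \<notin> ?E\<^sup>*"
  have uw: "{u} \<in> \<Delta>" "{w} \<in> \<Delta>" using \<Delta>'(4) u w by (meson UnionE bot_least insert_subset)+
  define c :: "'a set \<Rightarrow> 'k" where "c = (\<lambda>\<sigma>. (if \<sigma> = {u} then 1 else 0) - (if \<sigma> = {w} then 1 else 0))"
  have c: "c \<in> simplicial_chains 1 \<Delta>" unfolding simplicial_chains_def c_def using uw by (auto split: if_splits)
  have "boundary_map \<Delta> c = 0"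
  proof
    fix \<tau> show "boundary_map \<Delta> c \<tau> = 0 \<tau>"
    proof (cases "\<tau> = {}")
      case True
      have "boundary_map \<Delta> c {} = (\<Sum>v | {v} \<in> \<Delta>. (if v = u then 1 else 0) - (if v = w then 1 else 0))"
        unfolding boundary_map_def c_def by simp
      also have "\<dots> = 0"
        using finite_cofaces[OF \<Delta>, of "{}"] uw by (simp add: sum_subtractf)
      finally show ?thesis using True by simp
    next
      case False
      have "boundary_map \<Delta> c \<in> simplicial_chains 0 \<Delta>" using boundary_map_in_chains[OF \<Delta>, of c 0] c by simp
      then show ?thesis using False \<Delta>'(3)[of \<tau>] unfolding simplicial_chains_def by auto
    qed
  qed
  then obtain e where e: "c = boundary_map \<Delta> e"
    using acyclic_cycle_is_boundary[OF acyc c] by blast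
  define A where "A = {x \<in> \<Union>\<Delta>. (u, x) \<in> ?E\<^sup>*}"
  define Y where "Y = (\<lambda>x. {v. v \<notin> {x} \<and> insert v {x} \<in> \<Delta>})"
  define g where "g = (\<lambda>x v. (-1) ^ card {y\<in>{x}. vertex_less y v} * e (insert v {x}))"
  have finA: "finite A" by (rule finite_subset[OF _ \<Delta>'(5)]) (auto simp: A_def)
  have finY: "finite (Y x)" for x unfolding Y_def by (rule finite_cofaces[OF \<Delta>])
  have g: "g x v = (if vertex_less x v then -1 else 1) * e {x, v}" for x v
  proof -
    have "{y\<in>{x}. vertex_less y v} = (if vertex_less x v then {x} else {})" by auto
    then show ?thesis unfolding g_def by (simp add: insert_commute)
  qed
  have "(\<Sum>x\<in>A. c {x}) = (\<Sum>x\<in>A. (if x = u then 1 else 0) - (if x = w then 1 else 0))"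
    unfolding c_def by simp
  also have "\<dots> = 1" using finA u not by (simp add: sum_subtractf A_def)
  finally have "1 = (\<Sum>x\<in>A. c {x})" by simp
  also have "\<dots> = (\<Sum>x\<in>A. \<Sum>v\<in>Y x. g x v)" unfolding e boundary_map_def Y_def g_def by simp
  also have "\<dots> = (\<Sum>(x, v)\<in>Sigma A Y. g x v)" using finA finY by (intro sum.Sigma) auto
  also have "\<dots> = 0"
  proof (rule sum_antisymmetric)
    show "finite (Sigma A Y)" using finA finY by auto
    have "v \<in> A" if "x \<in> A" "{v, x} \<in> \<Delta>" for x v
    proof -
      have "(x, v) \<in> ?E" using that(2) by (simp add: insert_commute)
      then show ?thesis using that unfolding A_def by (auto intro: rtrancl_into_rtrancl)
    qed
    then show "sym (Sigma A Y)" by (auto simp: sym_def Y_def insert_commute)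
    show "x \<noteq> v" if "(x, v) \<in> Sigma A Y" for x v using that by (auto simp: Y_def)
    then show "g x v = - g v x" if "(x, v) \<in> Sigma A Y" for x v
      using that vertex_less_asym[of x v] by (auto simp: g insert_commute)
  qed
  finally show False by simp
qed

definition facets :: "'a set set \<Rightarrow> 'a set set" where
  "facets \<Delta> = {F\<in>\<Delta>. \<forall>G\<in>\<Delta>. F \<subseteq> G \<longrightarrow> F = G}"

definition facet_adjacency :: "nat \<Rightarrow> 'a set set \<Rightarrow> 'a set rel" where
  "facet_adjacency d \<Delta> = {(F, G). F \<in> facets \<Delta> \<and> G \<in> facets \<Delta> \<and> d \<le> card (F \<inter> G)}"

lemma face_in_facet:
  assumes "simplicial_complex \<Delta>" "\<sigma> \<in> \<Delta>"
  obtains F where "F \<in> facets \<Delta>" "\<sigma> \<subseteq> F"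
  using finite_has_maximal2[OF simplicial_complexD(1)[OF assms(1)] assms(2)]
  unfolding facets_def by auto

lemma insert_facet_of_link:
  assumes \<Delta>: "simplicial_complex \<Delta>" and "A \<in> facets (link \<Delta> {v})"
  shows "v \<notin> A" "insert v A \<in> facets \<Delta>"
proof -
  have A: "A \<in> link \<Delta> {v}" "\<And>B. B \<in> link \<Delta> {v} \<Longrightarrow> A \<subseteq> B \<Longrightarrow> A = B"
    using assms(2) unfolding facets_def by blast+
  show v: "v \<notin> A" using A(1) unfolding link_def by auto
  show "insert v A \<in> facets \<Delta>"
    unfolding facets_def
  proof (intro CollectI conjI ballI impI)
    show "insert v A \<in> \<Delta>" using A(1) unfolding link_def by simp
    fix G assume G: "G \<in> \<Delta>" "insert v A \<subseteq> G"
    have "A = G - {v}"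
    proof (rule A(2))
      have "insert v (G - {v}) = G" using G(2) by blast
      moreover have "G - {v} \<in> \<Delta>" by (rule simplicial_complexD(4)[OF \<Delta> G(1)]) auto
      ultimately show "G - {v} \<in> link \<Delta> {v}" using G(1) unfolding link_def by simp
      show "A \<subseteq> G - {v}" using G(2) v by blast
    qed
    then show "insert v A = G" using G(2) by blast
  qed
qed

lemma facet_of_link:
  assumes \<Delta>: "simplicial_complex \<Delta>" and F: "F \<in> facets \<Delta>" "v \<in> F"
  shows "F - {v} \<in> facets (link \<Delta> {v})"
  unfolding facets_def
proof (intro CollectI conjI ballI impI)
  have "F \<in> \<Delta>" using F(1) unfolding facets_def by simp
  then show "F - {v} \<in> link \<Delta> {v}"
    using F(2) simplicial_complexD(4)[OF \<Delta>, of F "F - {v}"] unfolding link_def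
    by (simp add: insert_absorb)
  fix B assume B: "B \<in> link \<Delta> {v}" "F - {v} \<subseteq> B"
  then have "insert v B \<in> \<Delta>" "v \<notin> B" unfolding link_def by auto
  moreover have "F \<subseteq> insert v B" using B(2) by blast
  ultimately show "F - {v} = B" using F(1) unfolding facets_def by blast
qed

lemma fold_acyclic_link:
  assumes \<Delta>: "simplicial_complex \<Delta>" and acyc: "fold_acyclic K (Suc d) \<Delta>" and v: "{v} \<in> \<Delta>"
  shows "fold_acyclic K d (link \<Delta> {v})"
  unfolding fold_acyclic_def
proof (intro ballI impI)
  fix \<sigma> assume \<sigma>: "\<sigma> \<in> link \<Delta> {v}" "card \<sigma> < d"
  then have "insert v \<sigma> \<in> \<Delta>" "v \<notin> \<sigma>" "finite \<sigma>"
    using simplicial_complexD(3)[OF \<Delta>] unfolding link_def by auto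
  moreover have "link (link \<Delta> {v}) \<sigma> = link \<Delta> (insert v \<sigma>)"
  proof (intro equalityI subsetI)
    fix \<tau> assume "\<tau> \<in> link \<Delta> (insert v \<sigma>)"
    then have \<tau>: "\<tau> \<union> insert v \<sigma> \<in> \<Delta>" "\<tau> \<inter> insert v \<sigma> = {}" unfolding link_def by auto
    have "\<rho> \<in> \<Delta>" if "\<rho> \<subseteq> \<tau> \<union> insert v \<sigma>" for \<rho>
      by (rule simplicial_complexD(4)[OF \<Delta> \<tau>(1) that])
    then have "\<tau> \<in> \<Delta>" "insert v \<tau> \<in> \<Delta>" "\<tau> \<union> \<sigma> \<in> \<Delta>" "insert v (\<tau> \<union> \<sigma>) \<in> \<Delta>" by auto
    then show "\<tau> \<in> link (link \<Delta> {v}) \<sigma>" using \<tau>(2) \<open>v \<notin> \<sigma>\<close> unfolding link_def by auto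
  qed (auto simp: link_def)
  ultimately show "acyclic_complex K (link (link \<Delta> {v}) \<sigma>)"
    using acyc \<sigma>(2) unfolding fold_acyclic_def by simp
qed

text \<open>
  Passing to the link of a vertex lowers \<open>d\<close> by one and removes that vertex from every intersection,
  so the induction hypothesis for the link joins any two facets containing the vertex. Facets
  containing different vertices are joined along a path of edges, each of which lies in some facet.
\<close>

lemma facets_connected:
  assumes "simplicial_complex \<Delta>" "fold_acyclic TYPE('k::field) d \<Delta>" "F \<in> facets \<Delta>" "G \<in> facets \<Delta>"
  shows "(F, G) \<in> (facet_adjacency d \<Delta>)\<^sup>*"
  using assms
proof (induction d arbitrary: \<Delta> F G)
  case 0
  then show ?case by (intro r_into_rtrancl) (simp add: facet_adjacency_def)
next
  case (Suc d)
  note \<Delta> = \<open>simplicial_complex \<Delta>\<close>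
  note \<Delta>' = simplicial_complexD[OF \<Delta>]
  let ?R = "facet_adjacency (Suc d) \<Delta>"
  have star: "(A, B) \<in> ?R\<^sup>*" if AB: "A \<in> facets \<Delta>" "B \<in> facets \<Delta>" "v \<in> A" "v \<in> B" for A B v
  proof -
    have v: "{v} \<in> \<Delta>" using AB(1,3) \<Delta>'(4)[of A "{v}"] unfolding facets_def by simp
    let ?L = "link \<Delta> {v}"
    have "(A - {v}, B - {v}) \<in> (facet_adjacency d ?L)\<^sup>*"
      using AB by (intro Suc.IH simplicial_complex_link[OF \<Delta> v] fold_acyclic_link[OF \<Delta> Suc.prems(2) v]
          facet_of_link[OF \<Delta>])
    moreover have "(insert v C, insert v D) \<in> ?R" if CD: "(C, D) \<in> facet_adjacency d ?L" for C D
    proof -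
      have C: "C \<in> facets ?L" "D \<in> facets ?L" "d \<le> card (C \<inter> D)"
        using CD unfolding facet_adjacency_def by auto
      have "finite C" using C(1) \<Delta>'(3) unfolding facets_def link_def by simp
      then have "Suc d \<le> card (insert v C \<inter> insert v D)"
        using C(3) insert_facet_of_link(1)[OF \<Delta> C(1)] by (simp flip: Int_insert_left_if1 add: Int_insert_left)
      then show ?thesis
        using insert_facet_of_link(2)[OF \<Delta> C(1)] insert_facet_of_link(2)[OF \<Delta> C(2)]
        unfolding facet_adjacency_def by simp
    qed
    ultimately have "(insert v (A - {v}), insert v (B - {v})) \<in> ?R\<^sup>*"
      by (induction rule: rtrancl_induct) (auto intro: rtrancl_into_rtrancl)
    then show ?thesis using AB by (simp add: insert_absorb)
  qed
  have "link \<Delta> {} = \<Delta>" unfolding link_def by simp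
  then have acyc: "acyclic_complex TYPE('k) \<Delta>"
    using Suc.prems(2) \<Delta>'(2) unfolding fold_acyclic_def by (metis card.empty zero_less_Suc)
  \<comment> \<open>the complex with only the empty face has reduced homology in degree \<open>-1\<close>, so every facet
    has a vertex from which to start a path\<close>
  have "\<Delta> \<noteq> {{}}"
    using acyclic_euler_characteristic[OF \<Delta> acyc, where 'b = int] by auto
  then have "A \<noteq> {}" if "A \<in> facets \<Delta>" for A using that unfolding facets_def by auto
  then obtain u w where uw: "u \<in> F" "w \<in> G" using Suc.prems(3,4) by blast
  then have "(u, w) \<in> {(x, y). {x, y} \<in> \<Delta>}\<^sup>*"
    using Suc.prems(3,4) unfolding facets_def
    by (intro acyclic_vertices_connected[OF \<Delta> acyc]) auto
  then show ?case using uw(2) \<open>G \<in> facets \<Delta>\<close>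
  proof (induction arbitrary: G rule: rtrancl_induct)
    case base
    then show ?case using star[OF Suc.prems(3) _ uw(1)] by blast
  next
    case (step y z)
    obtain H where H: "H \<in> facets \<Delta>" "{y, z} \<subseteq> H"
      using face_in_facet[OF \<Delta>] step.hyps(2) by blast
    then have "(F, H) \<in> ?R\<^sup>*" using step.IH by simp
    also have "(H, G) \<in> ?R\<^sup>*" using star[of H G z] H step.prems by simp
    finally show ?case .
  qed
qed

text \<open>
  A facet that is joined to a different facet shares at least \<open>d\<close> elements with its neighbour, and not
  all of its own, so it has more than \<open>d\<close> elements.
\<close>

lemma facets_eq_top_faces:
  assumes \<Delta>: "simplicial_complex \<Delta>" and acyc: "fold_acyclic TYPE('k::field) d \<Delta>"
    and le: "\<And>\<sigma>. \<sigma> \<in> \<Delta> \<Longrightarrow> card \<sigma> \<le> Suc d" and ex: "\<exists>\<sigma>\<in>\<Delta>. card \<sigma> = Suc d"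
  shows "facets \<Delta> = {\<sigma>\<in>\<Delta>. card \<sigma> = Suc d}"
proof
  have top: "\<sigma> \<in> facets \<Delta>" if "\<sigma> \<in> \<Delta>" "card \<sigma> = Suc d" for \<sigma>
    unfolding facets_def
  proof (intro CollectI conjI ballI impI that(1))
    fix G assume "G \<in> \<Delta>" "\<sigma> \<subseteq> G"
    then show "\<sigma> = G" using le[of G] that(2) simplicial_complexD(3)[OF \<Delta>] by (intro card_seteq) auto
  qed
  then show "{\<sigma>\<in>\<Delta>. card \<sigma> = Suc d} \<subseteq> facets \<Delta>" by blast
  show "facets \<Delta> \<subseteq> {\<sigma>\<in>\<Delta>. card \<sigma> = Suc d}"
  proof
    fix F assume F: "F \<in> facets \<Delta>"
    obtain G where G: "G \<in> \<Delta>" "card G = Suc d" using ex by blast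
    have "(F, G) \<in> (facet_adjacency d \<Delta>)\<^sup>*" using facets_connected[OF \<Delta> acyc F] top G by blast
    then have "F = G \<or> Suc d \<le> card F"
    proof (induction rule: converse_rtrancl_induct)
      case (step A B)
      have A: "A \<in> facets \<Delta>" "B \<in> facets \<Delta>" "d \<le> card (A \<inter> B)"
        using step.hyps(1) unfolding facet_adjacency_def by auto
      show ?case
      proof (cases "A = B")
        case False
        then have "A \<inter> B \<subset> A" using A(1,2) unfolding facets_def by blast
        moreover have "finite A" using A(1) simplicial_complexD(3)[OF \<Delta>] unfolding facets_def by simp
        ultimately have "card (A \<inter> B) < card A" by (rule psubset_card_mono[rotated])
        then show ?thesis using A(3) by simp
      qed (use step.IH in simp)
    qed simp
    then show "F \<in> {\<sigma>\<in>\<Delta>. card \<sigma> = Suc d}" using F G le[of F] unfolding facets_def by auto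
  qed
qed

section \<open>Boolean intervals\<close>

lemma boolean_interval_atLeastAtMost:
  assumes \<Delta>: "simplicial_complex \<Delta>" and "x \<subseteq> y" "y \<in> \<Delta>" "card (y - x) = k"
  shows "boolean_interval k \<Delta> {x..y}"
  unfolding boolean_interval_def
proof
  note \<Delta>' = simplicial_complexD[OF \<Delta>]
  have "{x..y} = poset_interval \<Delta> x y"
    using \<Delta>'(4)[OF \<open>y \<in> \<Delta>\<close>] unfolding poset_interval_def by auto
  then show "\<exists>a\<in>\<Delta>. \<exists>b\<in>\<Delta>. {x..y} = poset_interval \<Delta> a b"
    using \<Delta>'(4)[OF assms(3,2)] assms(3) by blast
  have "finite (y - x)" using \<Delta>'(3)[OF assms(3)] by simp
  then obtain h where h: "bij_betw h (y - x) {1..k}"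
    using assms(4) finite_same_card_bij[of "y - x" "{1..k}"] by auto
  have inj: "inj_on h (y - x)" using h by (rule bij_betw_imp_inj_on)
  have "bij_betw (\<lambda>z. z - x) {x..y} (Pow (y - x))"
    by (rule bij_betw_byWitness[of _ "\<lambda>z. z \<union> x"]) (use assms(2) in auto)
  then have "bij_betw (image h \<circ> (\<lambda>z. z - x)) {x..y} (Pow {1..k})"
    using bij_betw_Pow[OF h] by (rule bij_betw_trans)
  moreover have "z \<le> z' \<longleftrightarrow> (image h \<circ> (\<lambda>z. z - x)) z \<le> (image h \<circ> (\<lambda>z. z - x)) z'"
    if "z \<in> {x..y}" "z' \<in> {x..y}" for z z'
  proof -
    have "h u \<in> h ` (z' - x) \<longleftrightarrow> u \<in> z' - x" if "u \<in> z - x" for u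
      using that \<open>z \<in> {x..y}\<close> \<open>z' \<in> {x..y}\<close> by (intro inj_on_image_mem_iff[OF inj]) auto
    then have "h ` (z - x) \<subseteq> h ` (z' - x) \<longleftrightarrow> z - x \<subseteq> z' - x" by blast
    also have "\<dots> \<longleftrightarrow> z \<subseteq> z'" using that by auto
    finally show ?thesis by simp
  qed
  ultimately show "poset_isomorphic {x..y} (Pow {1..k})"
    unfolding poset_isomorphic_def by blast
qed

section \<open>Gluing facets along ridges\<close>

text \<open>
  Intervals are taken in the lattice of all sets. They are the intervals of the face poset as soon as
  the set \<open>\<Gamma>\<close> is closed under subsets.
\<close>

definition vertex_rooted_partition :: "nat \<Rightarrow> 'a set set \<Rightarrow> 'a set set set \<Rightarrow> bool" where
  "vertex_rooted_partition d \<Gamma> \<I> \<longleftrightarrow> partition_on \<Gamma> \<I> \<and>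
     (\<forall>I\<in>\<I>. \<exists>x y. I = {x..y} \<and> x \<subseteq> y \<and> card x \<le> 1 \<and> card (y - x) = d)"

text \<open>
  The new faces are the subsets of \<open>insert v G\<close> containing the new vertex \<open>v\<close>; the other subsets lie
  in \<open>G\<close> and are there already.
\<close>

lemma vertex_rooted_partition_add_facet:
  assumes part: "vertex_rooted_partition d \<Gamma> \<I>"
    and v: "v \<notin> \<Union>\<Gamma>" "v \<notin> G" and G: "Pow G \<subseteq> \<Gamma>" "card G = d"
  shows "vertex_rooted_partition d (\<Gamma> \<union> Pow (insert v G)) (insert {{v}..insert v G} \<I>)"
proof -
  let ?J = "{{v}..insert v G}"
  have \<Gamma>: "\<Gamma> = \<Union>\<I>" using part partition_onD1 unfolding vertex_rooted_partition_def by blast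
  have disj: "disjnt ?J (\<Union>\<I>)" using v(1) unfolding \<Gamma>[symmetric] disjnt_iff by auto
  have "\<Gamma> \<union> Pow (insert v G) - ?J = \<Gamma>" using G(1) v by (auto simp: Pow_insert)
  then have "partition_on (\<Gamma> \<union> Pow (insert v G)) (insert ?J \<I>)"
    using part unfolding vertex_rooted_partition_def partition_on_insert[OF disj] by auto
  moreover have "card (insert v G - {v}) = d" using v(2) G(2) by simp
  ultimately show ?thesis using part unfolding vertex_rooted_partition_def
    by (auto intro!: exI[of _ "{v}"] exI[of _ "insert v G"])
qed

lemma vertex_rooted_partition_simplex:
  assumes "card F = Suc d"
  shows "\<exists>\<I>. vertex_rooted_partition d (Pow F) \<I>"
proof -
  obtain v G where F: "F = insert v G" "v \<notin> G" "card G = d"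
    using assms by (auto simp: card_Suc_eq)
  have "vertex_rooted_partition d (Pow G) {{{}..G}}"
    unfolding vertex_rooted_partition_def
    using F(3) by (auto simp: partition_on_def intro!: exI[of _ "{}"] exI[of _ G])
  then have "vertex_rooted_partition d (Pow G \<union> Pow (insert v G)) (insert {{v}..insert v G} {{{}..G}})"
    using F by (intro vertex_rooted_partition_add_facet) auto
  moreover have "Pow G \<union> Pow (insert v G) = Pow F" using F(1) by auto
  ultimately show ?thesis by auto
qed

lemma rtrancl_exits:
  assumes "(a, b) \<in> R\<^sup>*" "a \<in> S" "b \<notin> S"
  obtains x y where "(x, y) \<in> R" "x \<in> S" "y \<notin> S"
  using assms(1,3,2) by (induction rule: rtrancl_induct) blast+

text \<open>
  Facets are collected one at a time, each sharing \<open>d\<close> elements with an earlier one. A step adds at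
  most one vertex, so the number of vertices never exceeds \<open>d\<close> plus the number of facets collected, and
  once it falls short of that it stays short. As long as it does not, every step has brought a new
  vertex and the partition extends; the count excludes a shortfall at the end.
\<close>

lemma vertex_rooted_partition_exists:
  assumes fin: "finite \<F>" and ne: "\<F> \<noteq> {}" and card: "\<And>F. F \<in> \<F> \<Longrightarrow> card F = Suc d"
    and conn: "\<And>F G. F \<in> \<F> \<Longrightarrow> G \<in> \<F> \<Longrightarrow> (F, G) \<in> {(A, B). A \<in> \<F> \<and> B \<in> \<F> \<and> d \<le> card (A \<inter> B)}\<^sup>*"
    and count: "card (\<Union>\<F>) = d + card \<F>"
  shows "\<exists>\<I>. vertex_rooted_partition d (\<Union>F\<in>\<F>. Pow F) \<I>"
proof -
  let ?R = "{(A, B). A \<in> \<F> \<and> B \<in> \<F> \<and> d \<le> card (A \<inter> B)}"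
  \<comment> \<open>the first alternative, a shortfall of vertices, is the branch that \<open>count\<close> refutes at the end\<close>
  define ok where "ok \<S> \<longleftrightarrow> card (\<Union>\<S>) < d + card \<S> \<or>
    card (\<Union>\<S>) = d + card \<S> \<and> (\<exists>\<I>. vertex_rooted_partition d (\<Union>F\<in>\<S>. Pow F) \<I>)" for \<S> :: "'a set set"
  have finF: "finite F" if "F \<in> \<F>" for F using card[OF that] card.infinite by fastforce
  have "\<exists>\<S>\<subseteq>\<F>. card \<S> = n \<and> ok \<S>" if "1 \<le> n" "n \<le> card \<F>" for n
    using that
  proof (induction n rule: nat_induct_at_least)
    case base
    obtain F where F: "F \<in> \<F>" using ne by blast
    have "ok {F}" unfolding ok_def using card[OF F] vertex_rooted_partition_simplex[of F d] by simp
    then show ?case using F by (intro exI[of _ "{F}"]) simp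
  next
    case (Suc n)
    then obtain \<S> where \<S>: "\<S> \<subseteq> \<F>" "card \<S> = n" "ok \<S>" by auto
    have finS: "finite \<S>" "finite (\<Union>\<S>)" using \<S>(1) fin finF by (auto intro: finite_subset)
    have "\<S> \<noteq> {}" "\<S> \<noteq> \<F>" using \<S>(2) Suc by auto
    then obtain A B where "A \<in> \<S>" "B \<in> \<F>" "B \<notin> \<S>" using \<S>(1) by blast
    then obtain F' F where F: "(F', F) \<in> ?R" "F' \<in> \<S>" "F \<notin> \<S>"
      using rtrancl_exits[OF conn[of A B], of \<S>] \<S>(1) by blast
    then have F\<F>: "F \<in> \<F>" "F' \<in> \<F>" "d \<le> card (F' \<inter> F)" by auto
    have "F' \<noteq> F" using F by blast
    then have "\<not> F \<subseteq> F'" using card_seteq[OF finF[OF F\<F>(2)], of F] card[OF F\<F>(1)] card[OF F\<F>(2)] by auto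
    then have "F' \<inter> F \<subset> F" by blast
    then have "card (F' \<inter> F) < Suc d" using psubset_card_mono[OF finF[OF F\<F>(1)], of "F' \<inter> F"] card[OF F\<F>(1)] by simp
    then have d: "card (F' \<inter> F) = d" using F\<F>(3) by simp
    then have "card (F - F' \<inter> F) = 1"
      using card_Diff_subset[of "F' \<inter> F" F] finF[OF F\<F>(1)] card[OF F\<F>(1)] by simp
    then obtain v where v: "F - F' \<inter> F = {v}" by (auto simp: card_1_singleton_iff)
    define G where "G = F' \<inter> F"
    have FG: "F = insert v G" "v \<notin> G" "G \<subseteq> F'" "card G = d" using v d unfolding G_def by auto
    have cS: "card (insert F \<S>) = Suc n" using F(3) finS \<S>(2) by simp
    have U: "\<Union>(insert F \<S>) = insert v (\<Union>\<S>)" using FG F(2) by auto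
    have "ok (insert F \<S>)"
    proof (cases "v \<in> \<Union>\<S>")
      case True
      then have "\<Union>(insert F \<S>) = \<Union>\<S>" using U by auto
      then show ?thesis using \<S>(2,3) cS unfolding ok_def by auto
    next
      case False
      then have cU: "card (\<Union>(insert F \<S>)) = Suc (card (\<Union>\<S>))" using U finS(2) by simp
      show ?thesis
      proof (cases "card (\<Union>\<S>) < d + card \<S>")
        case True then show ?thesis using cU cS \<S>(2) unfolding ok_def by simp
      next
        case nl: False
        then obtain \<I> where \<I>: "vertex_rooted_partition d (\<Union>F\<in>\<S>. Pow F) \<I>"
          and eq: "card (\<Union>\<S>) = d + card \<S>" using \<S>(3) unfolding ok_def by blast
        have "vertex_rooted_partition d ((\<Union>F\<in>\<S>. Pow F) \<union> Pow (insert v G)) (insert {{v}..insert v G} \<I>)"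
          using \<I> False FG F(2) by (intro vertex_rooted_partition_add_facet) auto
        moreover have "(\<Union>F\<in>\<S>. Pow F) \<union> Pow (insert v G) = (\<Union>F\<in>insert F \<S>. Pow F)"
          using FG(1) by auto
        ultimately show ?thesis using cU cS eq \<S>(2) unfolding ok_def by auto
      qed
    qed
    then show ?case using cS \<S>(1) F\<F>(1) by (intro exI[of _ "insert F \<S>"]) simp
  qed
  moreover have "1 \<le> card \<F>" using fin ne by (simp add: Suc_leI card_gt_0_iff)
  ultimately obtain \<S> where "\<S> \<subseteq> \<F>" "card \<S> = card \<F>" "ok \<S>" by blast
  then have "ok \<F>" using card_subset_eq[OF fin] by blast
  then show ?thesis using count unfolding ok_def by simp
qed

theorem corollary5p6:
  fixes d :: nat and \<Delta> :: "'a set set"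
  assumes "simplicial_complex \<Delta>"
    and "complex_dim \<Delta> = int d"
    and "fold_acyclic TYPE('k::field) d \<Delta>"
  shows "\<exists>\<I>. partition_on \<Delta> \<I> \<and> (\<forall>I\<in>\<I>. boolean_interval d \<Delta> I) \<and>
           subcomplex (\<Union>I\<in>\<I>. minimal_elements I) \<Delta>"
proof -
  note \<Delta> = simplicial_complexD[OF assms(1)]
  let ?\<F> = "{\<sigma>\<in>\<Delta>. card \<sigma> = Suc d}"
  have Max: "Max (face_dim ` \<Delta>) = int d" using assms(2) unfolding complex_dim_def .
  have le: "card \<sigma> \<le> Suc d" if "\<sigma> \<in> \<Delta>" for \<sigma>
  proof -
    have "face_dim \<sigma> \<le> int d" unfolding Max[symmetric] using \<Delta>(1) that by simp
    then show ?thesis unfolding face_dim_def by simp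
  qed
  have "int d \<in> face_dim ` \<Delta>" unfolding Max[symmetric] using \<Delta>(1,2) by (intro Max_in) auto
  then have ex: "\<exists>\<sigma>\<in>\<Delta>. card \<sigma> = Suc d" unfolding face_dim_def by force
  have \<F>: "facets \<Delta> = ?\<F>" by (rule facets_eq_top_faces[OF assms(1,3) le ex])
  have cover: "(\<Union>F\<in>?\<F>. Pow F) = \<Delta>"
  proof
    show "(\<Union>F\<in>?\<F>. Pow F) \<subseteq> \<Delta>" using \<Delta>(4) by auto
    show "\<Delta> \<subseteq> (\<Union>F\<in>?\<F>. Pow F)"
    proof
      fix \<sigma> assume "\<sigma> \<in> \<Delta>"
      then obtain F where "F \<in> facets \<Delta>" "\<sigma> \<subseteq> F" by (rule face_in_facet[OF assms(1)])
      then show "\<sigma> \<in> (\<Union>F\<in>?\<F>. Pow F)" unfolding \<F> by blast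
    qed
  qed
  then have "\<Union>\<Delta> = \<Union>?\<F>" by blast
  then have count: "card (\<Union>?\<F>) = d + card ?\<F>" using card_vertices_eq[OF assms(1,3) le] by simp
  have conn: "(F, G) \<in> {(A, B). A \<in> ?\<F> \<and> B \<in> ?\<F> \<and> d \<le> card (A \<inter> B)}\<^sup>*"
    if "F \<in> ?\<F>" "G \<in> ?\<F>" for F G
    using facets_connected[OF assms(1,3), of F G] that unfolding facet_adjacency_def \<F> by blast
  have "\<exists>\<I>. vertex_rooted_partition d (\<Union>F\<in>?\<F>. Pow F) \<I>"
    by (rule vertex_rooted_partition_exists[OF _ _ _ conn count]) (use ex \<Delta>(1) in auto)
  then obtain \<I> where "vertex_rooted_partition d \<Delta> \<I>"
    unfolding cover by (elim exE)
  then have part: "partition_on \<Delta> \<I>"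
    and I: "\<And>I. I \<in> \<I> \<Longrightarrow> \<exists>x y. I = {x..y} \<and> x \<subseteq> y \<and> card x \<le> 1 \<and> card (y - x) = d"
    unfolding vertex_rooted_partition_def by auto
  have \<Delta>\<I>: "\<Delta> = \<Union>\<I>" using part by (rule partition_onD1)
  have "boolean_interval d \<Delta> I" if "I \<in> \<I>" for I
  proof -
    obtain x y where xy: "I = {x..y}" "x \<subseteq> y" "card (y - x) = d" using I[OF \<open>I \<in> \<I>\<close>] by blast
    have "y \<in> \<Delta>" unfolding \<Delta>\<I> using that xy(1,2) by auto
    then show ?thesis using boolean_interval_atLeastAtMost[OF assms(1)] xy by blast
  qed
  moreover have "subcomplex (\<Union>I\<in>\<I>. minimal_elements I) \<Delta>"
  proof -
    let ?M = "\<Union>I\<in>\<I>. minimal_elements I"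
    have sub: "?M \<subseteq> \<Delta>" unfolding \<Delta>\<I> minimal_elements_def by auto
    have small: "card x \<le> 1" if x: "x \<in> ?M" for x
    proof -
      obtain I where I': "I \<in> \<I>" "x \<in> minimal_elements I" using x by blast
      obtain a b where ab: "I = {a..b}" "a \<subseteq> b" "card a \<le> 1" using I[OF I'(1)] by blast
      have min: "x \<in> {a..b}" "\<And>z. z \<in> {a..b} \<Longrightarrow> \<not> z < x"
        using I'(2) unfolding minimal_elements_def ab(1) by simp_all
      then have "a \<le> x" "\<not> a < x" using min(2)[of a] ab(2) by simp_all
      then have "x = a" by (simp add: less_le)
      then show ?thesis using ab(3) by simp
    qed
    obtain I where "I \<in> \<I>" "{} \<in> I" using \<Delta>(2) unfolding \<Delta>\<I> by (elim UnionE)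
    then have empty: "{} \<in> ?M" unfolding minimal_elements_def by (intro UN_I[of I]) simp_all
    have down: "\<tau> \<in> ?M" if \<sigma>\<tau>: "\<sigma> \<in> ?M" "\<tau> \<subseteq> \<sigma>" for \<sigma> \<tau>
    proof -
      have "finite \<sigma>" by (rule \<Delta>(3)[OF subsetD[OF sub \<sigma>\<tau>(1)]])
      then consider "\<sigma> = {}" | v where "\<sigma> = {v}"
        using small[OF \<sigma>\<tau>(1)] by (auto simp: le_Suc_eq card_1_singleton_iff)
      then have "\<tau> = {} \<or> \<tau> = \<sigma>" using \<sigma>\<tau>(2) by cases auto
      then show ?thesis using \<sigma>\<tau>(1) empty by (elim disjE) simp_all
    qed
    have "simplicial_complex ?M"
      unfolding simplicial_complex_def
    proof (intro conjI exI[of _ "\<Union>\<Delta>"] ballI allI impI)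
      show "?M \<noteq> {}" by (rule notI) (use empty in simp)
      show "finite (\<Union>\<Delta>)" by (rule \<Delta>(5))
      show "?M \<subseteq> Pow (\<Union>\<Delta>)" using sub by (rule order_trans) (rule subset_Pow_Union)
    qed (rule down)
    then show ?thesis unfolding subcomplex_def using sub by simp
  qed
  ultimately show ?thesis using part by blast
qed

end
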